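(* Let $a<b$ be real numbers and let $f:[a,b]\rightarrow\mathbb{R}$ be continuous on $[a,b]$ and twice differentiable on $(a,b)$, with second derivative $f'':(a,b)\rightarrow\mathbb{R}$ belonging to $L_1(a,b)$. Then $$\left|\frac{f(a)+f(b)}{2}-(b-a)\frac{f'(b)-f'(a)}{4}-\frac{1}{b-a}\int_a^bf(t)\,dt\right|\leq\frac16(b-a)^2\|f''\|_\infty .$$
   Context: Here $\|f''\|_\infty=\sup_{t\in(a,b)}|f''(t)|$ (the right-hand side being $+\infty$ if $f''$ is unbounded). The symbols $f'(a)$ and $f'(b)$ denote the one-sided derivatives of $f$ at the endpoints. *)

theory Defs
  imports "HOL-Analysis.Analysis"
begin

end

theory Submission imports Defs begin

text \<open>
  Write \<open>M\<close> for the supremum of \<open>\<bar>f''\<bar>\<close>. If \<open>M\<close> is infinite, so is the right-hand side. Otherwise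
  \<open>f'\<close> is Lipschitz with constant \<open>M\<close>, so it has limits \<open>A\<close> at \<open>a\<close> and \<open>B\<close> at \<open>b\<close>, which are the
  one-sided derivatives of \<open>f\<close> there, and \<open>f\<close> obeys a quadratic Taylor estimate from each endpoint:
  \<open>\<bar>f t - f a - A * (t - a)\<bar> \<le> M / 2 * (t - a)\<^sup>2\<close> and \<open>\<bar>f t - f b + B * (b - t)\<bar> \<le> M / 2 * (b - t)\<^sup>2\<close>
  (\<open>endpoint_taylor_right\<close> and \<open>endpoint_taylor_left\<close>).

  The quadrature rule is exactly the mean over the interval of the average of these two Taylor
  lines, since \<open>t - a\<close> and \<open>b - t\<close> both have mean \<open>(b - a) / 2\<close>. Its error is therefore at most the
  mean of \<open>M / 4 * ((t - a)\<^sup>2 + (b - t)\<^sup>2)\<close>, which is \<open>M / 6 * (b - a)\<^sup>2\<close>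
  (\<open>two_endpoint_quadrature_error\<close>).
\<close>

text \<open>
  The number \<open>A\<close> is the limit of \<open>g\<close> at \<open>a\<close>. It is obtained without a limit argument: the
  Lipschitz condition makes every value \<open>g t - M * (t - a)\<close> a lower bound for all the values
  \<open>g s + M * (s - a)\<close>, so a number separating the two families exists.
\<close>

lemma lipschitz_value_at_left_endpoint:
  fixes g :: "real \<Rightarrow> real"
  assumes "a < b" and "M \<ge> 0"
    and lip: "\<And>s t. \<lbrakk>s \<in> {a<..<b}; t \<in> {a<..<b}\<rbrakk> \<Longrightarrow> \<bar>g t - g s\<bar> \<le> M * \<bar>t - s\<bar>"
  obtains A where "\<And>t. t \<in> {a<..<b} \<Longrightarrow> \<bar>g t - A\<bar> \<le> M * (t - a)"
proof -
  define A where "A = (SUP t\<in>{a<..<b}. g t - M * (t - a))"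
  have sep: "g t - M * (t - a) \<le> g s + M * (s - a)"
    if "s \<in> {a<..<b}" "t \<in> {a<..<b}" for s t
  proof -
    have "g t - g s \<le> M * \<bar>t - s\<bar>" using lip[OF that] by linarith
    also have "\<dots> \<le> M * ((t - a) + (s - a))"
      using that \<open>M \<ge> 0\<close> by (intro mult_left_mono) auto
    finally show ?thesis by (simp add: algebra_simps)
  qed
  have ne: "{a<..<b} \<noteq> {}" using \<open>a < b\<close> by simp
  have "\<bar>g t - A\<bar> \<le> M * (t - a)" if t: "t \<in> {a<..<b}" for t
  proof -
    have "A \<le> g t + M * (t - a)"
      unfolding A_def by (rule cSUP_least[OF ne]) (rule sep[OF t])
    moreover have "g t - M * (t - a) \<le> A"
      unfolding A_def by (rule cSUP_upper[OF t]) (auto intro!: bdd_aboveI2 sep[OF t])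
    ultimately show ?thesis by linarith
  qed
  then show thesis by (rule that)
qed

text \<open>
  Each sign of the estimate is a monotonicity statement: the derivative of
  \<open>M / 2 * (t - a)\<^sup>2 - (f t - A * (t - a))\<close> is \<open>M * (t - a) - (f' t - A)\<close>, which is nonnegative,
  and likewise with \<open>f\<close> and \<open>A\<close> negated. The factor \<open>c\<close> in the proof is this sign.
\<close>

lemma taylor_bound_from_derivative_bound:
  fixes f :: "real \<Rightarrow> real"
  assumes cont: "continuous_on {a..b} f"
    and der: "\<And>t. t \<in> {a<..<b} \<Longrightarrow> (f has_real_derivative f' t) (at t)"
    and bnd: "\<And>t. t \<in> {a<..<b} \<Longrightarrow> \<bar>f' t - A\<bar> \<le> M * (t - a)"
    and t: "t \<in> {a..b}"
  shows "\<bar>f t - f a - A * (t - a)\<bar> \<le> M / 2 * (t - a)\<^sup>2"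
proof -
  have upper: "c * (f t - f a - A * (t - a)) \<le> M / 2 * (t - a)\<^sup>2" if c: "\<bar>c\<bar> = 1" for c :: real
  proof -
    define h where "h = (\<lambda>x. M / 2 * (x - a)\<^sup>2 - c * (f x - A * (x - a)))"
    have "h a \<le> h t"
    proof (rule DERIV_nonneg_imp_increasing_open[where f = h])
      show "a \<le> t" using t by simp
      show "continuous_on {a..t} h"
        unfolding h_def using t by (intro continuous_intros continuous_on_subset[OF cont]) auto
      fix x assume x: "a < x" "x < t"
      then have x': "x \<in> {a<..<b}" using t by simp
      have "(h has_real_derivative M * (x - a) - c * (f' x - A)) (at x)"
        unfolding h_def by (auto intro!: derivative_eq_intros der[OF x'])
      moreover have "c * (f' x - A) \<le> M * (x - a)"
        using bnd[OF x'] c by (metis abs_le_D1 abs_mult mult_1)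
      ultimately show "\<exists>y. (h has_real_derivative y) (at x) \<and> 0 \<le> y"
        by (intro exI[of _ "M * (x - a) - c * (f' x - A)"]) simp
    qed
    then show ?thesis by (simp add: h_def algebra_simps)
  qed
  show ?thesis using upper[of 1] upper[of "-1"] by (intro abs_leI) simp_all
qed

lemma has_vector_derivative_of_quadratic_error:
  fixes f :: "real \<Rightarrow> real"
  assumes err: "\<And>t. t \<in> S \<Longrightarrow> \<bar>f t - f p - A * (t - p)\<bar> \<le> K * (t - p)\<^sup>2"
    and "p \<in> S"
  shows "(f has_vector_derivative A) (at p within S)"
proof -
  have "((\<lambda>t. (f t - f p) / (t - p)) \<longlongrightarrow> A) (at p within S)"
  proof (rule Lim_transform_bound[THEN LIM_zero_cancel])
    show "((\<lambda>t. K * \<bar>t - p\<bar>) \<longlongrightarrow> 0) (at p within S)"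
      by (auto intro!: tendsto_eq_intros)
    show "\<forall>\<^sub>F t in at p within S. norm ((f t - f p) / (t - p) - A) \<le> norm (K * \<bar>t - p\<bar>)"
      unfolding eventually_at_filter
    proof (intro always_eventually allI impI)
      fix t assume t: "t \<noteq> p" "t \<in> S"
      have "\<bar>(f t - f p) / (t - p) - A\<bar> = \<bar>f t - f p - A * (t - p)\<bar> / \<bar>t - p\<bar>"
        using t by (simp add: abs_divide[symmetric] diff_divide_distrib)
      also have "\<dots> \<le> K * (t - p)\<^sup>2 / \<bar>t - p\<bar>"
        using err[OF t(2)] by (rule divide_right_mono) simp
      also have "\<dots> = K * \<bar>t - p\<bar>"
        using t by (simp add: divide_eq_eq power2_eq_square)
      finally show "norm ((f t - f p) / (t - p) - A) \<le> norm (K * \<bar>t - p\<bar>)"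
        by simp
    qed
  qed
  then show ?thesis
    by (simp add: has_real_derivative_iff_has_vector_derivative[symmetric] has_field_derivative_iff)
qed

lemma endpoint_taylor_right:
  fixes f f' f'' :: "real \<Rightarrow> real"
  assumes "a < b"
    and cont: "continuous_on {a..b} f"
    and d1: "\<And>t. t \<in> {a<..<b} \<Longrightarrow> (f has_real_derivative f' t) (at t)"
    and d2: "\<And>t. t \<in> {a<..<b} \<Longrightarrow> (f' has_real_derivative f'' t) (at t)"
    and M: "\<And>t. t \<in> {a<..<b} \<Longrightarrow> \<bar>f'' t\<bar> \<le> M"
  obtains A where "(f has_vector_derivative A) (at_right a)"
    and "\<And>t. t \<in> {a..b} \<Longrightarrow> \<bar>f t - f a - A * (t - a)\<bar> \<le> M / 2 * (t - a)\<^sup>2"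
proof -
  have "M \<ge> 0" using M[of "(a + b) / 2"] \<open>a < b\<close> by simp
  have lip: "\<bar>f' t - f' s\<bar> \<le> M * \<bar>t - s\<bar>" if "s \<in> {a<..<b}" "t \<in> {a<..<b}" for s t
    using field_differentiable_bound[of "{a<..<b}" f' f'' M t s] d2 M that
    by (simp add: has_field_derivative_at_within)
  obtain A where A: "\<And>t. t \<in> {a<..<b} \<Longrightarrow> \<bar>f' t - A\<bar> \<le> M * (t - a)"
    using lipschitz_value_at_left_endpoint[of a b M f'] \<open>a < b\<close> \<open>M \<ge> 0\<close> lip by blast
  have err: "\<bar>f t - f a - A * (t - a)\<bar> \<le> M / 2 * (t - a)\<^sup>2" if "t \<in> {a..b}" for t
    using taylor_bound_from_derivative_bound[OF cont d1 A that] .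
  have "(f has_vector_derivative A) (at a within {a..b})"
    by (rule has_vector_derivative_of_quadratic_error[OF err]) (use \<open>a < b\<close> in auto)
  then show thesis
    using that err by (simp add: at_within_Icc_at_right[OF \<open>a < b\<close>])
qed

text \<open>The mirror image of the previous estimate under the reflection \<open>t \<mapsto> - t\<close>.\<close>

lemma endpoint_taylor_left:
  fixes f f' f'' :: "real \<Rightarrow> real"
  assumes "a < b"
    and cont: "continuous_on {a..b} f"
    and d1: "\<And>t. t \<in> {a<..<b} \<Longrightarrow> (f has_real_derivative f' t) (at t)"
    and d2: "\<And>t. t \<in> {a<..<b} \<Longrightarrow> (f' has_real_derivative f'' t) (at t)"
    and M: "\<And>t. t \<in> {a<..<b} \<Longrightarrow> \<bar>f'' t\<bar> \<le> M"
  obtains B where "(f has_vector_derivative B) (at_left b)"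
    and "\<And>t. t \<in> {a..b} \<Longrightarrow> \<bar>f t - f b + B * (b - t)\<bar> \<le> M / 2 * (b - t)\<^sup>2"
proof -
  obtain C where C: "\<And>t. t \<in> {-b..-a} \<Longrightarrow>
      \<bar>f (- t) - f (- (- b)) - C * (t - (- b))\<bar> \<le> M / 2 * (t - (- b))\<^sup>2"
  proof (rule endpoint_taylor_right[where f = "\<lambda>t. f (- t)" and f' = "\<lambda>t. - f' (- t)"
        and f'' = "\<lambda>t. f'' (- t)" and a = "- b" and b = "- a" and M = M])
    show "- b < - a" using \<open>a < b\<close> by simp
    show "continuous_on {- b..- a} (\<lambda>t. f (- t))"
      by (rule continuous_on_compose2[OF cont]) (auto intro!: continuous_intros)
    fix t assume "t \<in> {- b<..<- a}"
    then have t: "- t \<in> {a<..<b}" by auto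
    show "((\<lambda>t. f (- t)) has_real_derivative - f' (- t)) (at t)"
      using d1[OF t] by (simp add: DERIV_mirror)
    show "((\<lambda>t. - f' (- t)) has_real_derivative f'' (- t)) (at t)"
      using DERIV_minus[of "\<lambda>t. f' (- t)" "- f'' (- t)" t] d2[OF t] by (simp add: DERIV_mirror)
    show "\<bar>f'' (- t)\<bar> \<le> M" using M[OF t] .
  qed blast
  have err: "\<bar>f t - f b + (- C) * (b - t)\<bar> \<le> M / 2 * (b - t)\<^sup>2" if "t \<in> {a..b}" for t
    using C[of "- t"] that by (simp add: algebra_simps)
  have "\<bar>f t - f b - (- C) * (t - b)\<bar> \<le> M / 2 * (t - b)\<^sup>2" if "t \<in> {a..b}" for t
    using C[of "- t"] that by (simp add: algebra_simps power2_commute)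
  then have "(f has_vector_derivative - C) (at b within {a..b})"
    by (rule has_vector_derivative_of_quadratic_error) (use \<open>a < b\<close> in auto)
  then show thesis
    using that[of "- C"] err by (simp add: at_within_Icc_at_left[OF \<open>a < b\<close>])
qed

text \<open>
  Averaging the two Taylor estimates and integrating gives the quadrature error; the averaged
  Taylor lines integrate to \<open>(b - a) * (f a + f b) / 2 + (b - a)\<^sup>2 * (A - B) / 4\<close>.
\<close>

lemma two_endpoint_quadrature_error:
  fixes f :: "real \<Rightarrow> real"
  assumes "a < b"
    and cont: "continuous_on {a..b} f"
    and A: "\<And>t. t \<in> {a..b} \<Longrightarrow> \<bar>f t - f a - A * (t - a)\<bar> \<le> M / 2 * (t - a)\<^sup>2"
    and B: "\<And>t. t \<in> {a..b} \<Longrightarrow> \<bar>f t - f b + B * (b - t)\<bar> \<le> M / 2 * (b - t)\<^sup>2"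
  shows "\<bar>(f a + f b) / 2 - (b - a) * ((B - A) / 4) - 1 / (b - a) * integral {a..b} f\<bar>
    \<le> 1 / 6 * (b - a)\<^sup>2 * M"
proof -
  define p where "p = (\<lambda>t. (f a + f b) / 2 + A / 2 * (t - a) - B / 2 * (b - t))"
  define q where "q = (\<lambda>t. M / 4 * ((t - a)\<^sup>2 + (b - t)\<^sup>2))"
  define L where "L = b - a"
  have L: "L > 0" "b = a + L" using \<open>a < b\<close> by (simp_all add: L_def)
  have p: "(p has_integral L * (f a + f b) / 2 + L\<^sup>2 * (A - B) / 4) {a..b}"
  proof -
    define P where "P = (\<lambda>t. (f a + f b) / 2 * t + A / 4 * (t - a)\<^sup>2 + B / 4 * (b - t)\<^sup>2)"
    have "(P has_real_derivative p t) (at t within {a..b})" for t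
      unfolding P_def p_def by (rule derivative_eq_intros refl | simp add: field_simps)+
    then have "(p has_integral P b - P a) {a..b}"
      using \<open>a < b\<close> by (intro fundamental_theorem_of_calculus)
        (auto simp flip: has_real_derivative_iff_has_vector_derivative)
    also have "P b - P a = L * (f a + f b) / 2 + L\<^sup>2 * (A - B) / 4"
      by (simp add: P_def L_def field_simps power2_eq_square)
    finally show ?thesis .
  qed
  have q: "(q has_integral M * L ^ 3 / 6) {a..b}"
  proof -
    define Q where "Q = (\<lambda>t. M / 12 * ((t - a) ^ 3 - (b - t) ^ 3))"
    have "(Q has_real_derivative q t) (at t within {a..b})" for t
      unfolding Q_def q_def by (rule derivative_eq_intros refl | simp add: algebra_simps)+
    then have "(q has_integral Q b - Q a) {a..b}"
      using \<open>a < b\<close> by (intro fundamental_theorem_of_calculus)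
        (auto simp flip: has_real_derivative_iff_has_vector_derivative)
    also have "Q b - Q a = M * L ^ 3 / 6"
      by (simp add: Q_def L_def)
    finally show ?thesis .
  qed
  have f: "f integrable_on {a..b}" using cont by (rule integrable_continuous_real)
  have "\<bar>p t - f t\<bar> \<le> q t" if "t \<in> {a..b}" for t
  proof -
    define X Y where "X = f t - f a - A * (t - a)" and "Y = f t - f b + B * (b - t)"
    have "\<bar>X + Y\<bar> \<le> M / 2 * (t - a)\<^sup>2 + M / 2 * (b - t)\<^sup>2"
      using abs_triangle_ineq[of X Y] A[OF that] B[OF that] by (simp flip: X_def Y_def)
    also have "\<dots> = 2 * q t" by (simp add: q_def field_simps)
    also have "X + Y = - 2 * (p t - f t)" by (simp add: X_def Y_def p_def field_simps)
    finally show ?thesis by (simp add: abs_mult)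
  qed
  then have "norm (integral {a..b} (\<lambda>t. p t - f t)) \<le> integral {a..b} q"
    by (intro integral_norm_bound_integral integrable_diff f has_integral_integrable[OF p]
        has_integral_integrable[OF q]) auto
  then have "\<bar>L * (f a + f b) / 2 + L\<^sup>2 * (A - B) / 4 - integral {a..b} f\<bar> \<le> M * L ^ 3 / 6"
    using integral_diff[OF has_integral_integrable[OF p] f] integral_unique[OF p]
      integral_unique[OF q] by simp
  then have "\<bar>L * (f a + f b) / 2 + L\<^sup>2 * (A - B) / 4 - integral {a..b} f\<bar> / L \<le> M * L ^ 3 / 6 / L"
    using L by (intro divide_right_mono) auto
  also have "M * L ^ 3 / 6 / L = 1 / 6 * L\<^sup>2 * M"
    using L by (simp add: power2_eq_square power3_eq_cube)
  also have "\<bar>L * (f a + f b) / 2 + L\<^sup>2 * (A - B) / 4 - integral {a..b} f\<bar> / L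
      = \<bar>(L * (f a + f b) / 2 + L\<^sup>2 * (A - B) / 4 - integral {a..b} f) / L\<bar>"
    using L(1) by (simp add: abs_divide)
  also have "(L * (f a + f b) / 2 + L\<^sup>2 * (A - B) / 4 - integral {a..b} f) / L
      = (f a + f b) / 2 - L * ((B - A) / 4) - 1 / L * integral {a..b} f"
    using L(1) by (simp add: field_simps power2_eq_square)
  finally show ?thesis by (simp add: L_def)
qed

theorem corollary8:
  fixes f f' f'' :: "real \<Rightarrow> real" and a b :: real
  assumes "a < b"
    and "continuous_on {a..b} f"
    and "\<And>t. t \<in> {a<..<b} \<Longrightarrow> (f has_real_derivative f' t) (at t)"
    and "\<And>t. t \<in> {a<..<b} \<Longrightarrow> (f' has_real_derivative f'' t) (at t)"
    and "f'' absolutely_integrable_on {a<..<b}"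
  shows "ereal \<bar>(f a + f b) / 2
            - (b - a) * ((vector_derivative f (at_left b) - vector_derivative f (at_right a)) / 4)
            - 1 / (b - a) * integral {a..b} f\<bar>
         \<le> ereal (1 / 6 * (b - a)\<^sup>2) * (SUP t\<in>{a<..<b}. ereal \<bar>f'' t\<bar>)"
proof -
  define S where "S = (SUP t\<in>{a<..<b}. ereal \<bar>f'' t\<bar>)"
  have le_S: "ereal \<bar>f'' t\<bar> \<le> S" if "t \<in> {a<..<b}" for t
    unfolding S_def using that by (rule SUP_upper)
  have "S \<noteq> - \<infinity>" using le_S[of "(a + b) / 2"] \<open>a < b\<close> by auto
  then consider (infinite) "S = \<infinity>" | (finite) M where "S = ereal M"
    by (cases S) auto
  then show ?thesis
  proof cases
    case infinite
    then show ?thesis using \<open>a < b\<close> by (simp flip: S_def)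
  next
    case finite
    then have M: "\<bar>f'' t\<bar> \<le> M" if "t \<in> {a<..<b}" for t
      using le_S[OF that] by simp
    obtain A where A: "(f has_vector_derivative A) (at_right a)"
      and A_err: "\<And>t. t \<in> {a..b} \<Longrightarrow> \<bar>f t - f a - A * (t - a)\<bar> \<le> M / 2 * (t - a)\<^sup>2"
      using endpoint_taylor_right[OF assms(1-4) M] by blast
    obtain B where B: "(f has_vector_derivative B) (at_left b)"
      and B_err: "\<And>t. t \<in> {a..b} \<Longrightarrow> \<bar>f t - f b + B * (b - t)\<bar> \<le> M / 2 * (b - t)\<^sup>2"
      using endpoint_taylor_left[OF assms(1-4) M] by blast
    have "vector_derivative f (at_right a) = A" "vector_derivative f (at_left b) = B"
      using A B by (auto intro!: vector_derivative_within simp: trivial_limit_at_right_real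
          trivial_limit_at_left_real)
    then show ?thesis
      using two_endpoint_quadrature_error[OF assms(1,2) A_err B_err] finite
      by (simp flip: S_def)
  qed
qed

end
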